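(* Let $f(z) = z^n + \xi_{n-1}z^{n-1} + \cdots + \xi_1 z + \xi_0$ be a degree $n$ random monic polynomial with integer coefficients, i.e. $\xi_0,\dots,\xi_{n-1}$ are integer-valued random variables (not necessarily independent or identically distributed). Let $M > 0$ and $2 \le k \le n$. Let $\Omega \subseteq \{z \in \mathbb{C} : |z| \le M\}$, and suppose there exists $p \in [0,1]$ such that $$\sup_{z\in\Omega} \mathbb{P}(f(z) = 0) \le p.$$ Then the probability that $f$ has an algebraic root of degree at most $k$ in $\Omega$ (that is, a root in $\Omega$ that is an algebraic number of degree at most $k$) is at most $$p\,(eM)^{k^2} + \mathbb{P}\big(|\lambda_i(f)| > M \text{ for some } i\big),$$ where $\lambda_1(f),\dots,\lambda_n(f)$ are the roots of $f$ in $\mathbb{C}$, counted with multiplicity. If $k=1$, the result holds if $p(eM)^{k^2}$ is replaced with $p(3M)$ in this bound.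
   Context: The degree of an algebraic number $\alpha\in\mathbb{C}$ is the degree of its minimal polynomial over $\mathbb{Q}$, i.e. of the unique monic polynomial with rational coefficients of least degree having $\alpha$ as a root. Here $e$ is the base of the natural logarithm.
   Formalization: The formal theorem assumes M ≥ 1/e for k ≥ 2 and M ≥ 1/3 for k = 1, instead of only M > 0; for smaller M the stated bound fails, e.g. for f = z^n surely, Ω = {0}, p = 1. *)

theory Defs
  imports "HOL-Probability.Probability" "HOL-Computational_Algebra.Computational_Algebra"
begin

definition is_min_rat_poly :: "complex \<Rightarrow> rat poly \<Rightarrow> bool" where
  "is_min_rat_poly \<alpha> q \<longleftrightarrow>
     lead_coeff q = 1 \<and> poly (map_poly of_rat q) \<alpha> = 0 \<and>
     (\<forall>r. lead_coeff r = 1 \<and> poly (map_poly of_rat r) \<alpha> = 0 \<longrightarrow> degree q \<le> degree r)"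

lemma is_min_rat_poly_ex1:
  assumes "algebraic \<alpha>"
  shows "\<exists>!q. is_min_rat_poly \<alpha> q"
proof -
  let ?R = "\<lambda>q::rat poly. poly (map_poly of_rat q) \<alpha>"
  have R_diff: "?R (q - r) = ?R q - ?R r" for q r
  proof -
    have "map_poly of_rat (q - r) = (map_poly of_rat q - map_poly of_rat r :: complex poly)"
      by (rule poly_eqI) (simp add: coeff_map_poly of_rat_diff)
    then show ?thesis by simp
  qed
  have R_smult: "?R (smult c q) = of_rat c * ?R q" for c q
    by (simp add: map_poly_smult of_rat_mult)
  have normalise: "\<exists>r. (lead_coeff r = 1 \<and> ?R r = 0) \<and> degree r = degree q"
    if "q \<noteq> 0" "?R q = 0" for q
    using that
    by (intro exI[of _ "smult (inverse (lead_coeff q)) q"]) (simp add: R_smult)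
  obtain p where p: "\<And>i. coeff p i \<in> \<rat>" "p \<noteq> 0" "poly p \<alpha> = 0"
    using assms unfolding algebraic_altdef by blast
  obtain q where q: "p = map_poly of_rat q" using p(1) by (rule ratpolyE)
  have "q \<noteq> 0" "?R q = 0" using p q by auto
  then obtain m where m: "lead_coeff m = 1 \<and> ?R m = 0" using normalise by blast
  obtain r where r: "is_min_rat_poly \<alpha> r"
    using ex_has_least_nat[of "\<lambda>m. lead_coeff m = 1 \<and> ?R m = 0" m degree] m
    unfolding is_min_rat_poly_def by blast
  show ?thesis
  proof (rule ex1I[of _ r], rule r)
    fix s assume s: "is_min_rat_poly \<alpha> s"
    have deg: "degree s = degree r"
      using r s unfolding is_min_rat_poly_def by (meson le_antisym)
    show "s = r"
    proof (rule ccontr)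
      assume "s \<noteq> r"
      then have nz: "s - r \<noteq> 0" by simp
      have root: "?R (s - r) = 0"
        using r s unfolding is_min_rat_poly_def R_diff by simp
      obtain t where t: "lead_coeff t = 1 \<and> ?R t = 0" "degree t = degree (s - r)"
        using normalise[OF nz root] by blast
      have "degree r \<le> degree (s - r)"
        using r t unfolding is_min_rat_poly_def by metis
      moreover have "degree (s - r) \<le> degree r"
        using degree_diff_le_max[of s r] deg by simp
      ultimately have "lead_coeff (s - r) = coeff s (degree s) - coeff r (degree r)"
        using deg by simp
      then have "lead_coeff (s - r) = 0"
        using r s unfolding is_min_rat_poly_def by simp
      with nz show False using leading_coeff_0_iff by blast
    qed
  qed
qed

definition min_rat_poly :: "complex \<Rightarrow> rat poly" where
  "min_rat_poly \<alpha> = (THE q. is_min_rat_poly \<alpha> q)"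

text \<open>Only meaningful under \<^prop>\<open>algebraic \<alpha>\<close>; otherwise \<^const>\<open>min_rat_poly\<close> is unspecified.\<close>
definition algebraic_degree :: "complex \<Rightarrow> nat" where
  "algebraic_degree \<alpha> = degree (min_rat_poly \<alpha>)"

text \<open>The polynomial \<open>f\<close> at the outcome \<open>\<omega>\<close>; its integer coefficients are embedded in the complex numbers.\<close>
definition random_poly :: "nat \<Rightarrow> (nat \<Rightarrow> 'a \<Rightarrow> int) \<Rightarrow> 'a \<Rightarrow> complex poly" where
  "random_poly n \<xi> \<omega> = monom 1 n + (\<Sum>i<n. monom (of_int (\<xi> i \<omega>)) i)"

end

theory Submission
  imports Defs
begin

text \<open>Let \<open>z\<close> be a root of \<open>f\<close> of degree \<open>d \<le> k\<close>, and suppose that no root of \<open>f\<close> exceeds \<open>M\<close> in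
  absolute value. By Gauss' lemma the minimal polynomial \<open>g\<close> of \<open>z\<close> is an integer polynomial dividing \<open>f\<close>,
  so \<open>X^(k-d) g\<close> is a monic integer polynomial of degree \<open>k\<close> with all roots in the disc of radius \<open>M\<close>,
  and it determines \<open>g\<close>. If \<open>M < 1\<close>, the only such polynomial is \<open>X^k\<close>, since its constant
  coefficient is an integer of absolute value at most \<open>M^k < 1\<close>. If \<open>M \<ge> 1\<close>, each of the \<open>k\<close> lower
  coefficients is at most \<open>2^(k-1) M^k\<close> in absolute value, which leaves at most
  \<open>(2^k + 1) M^k \<le> (eM)^k\<close> choices for it when \<open>k \<ge> 2\<close>. A union bound over these polynomials, with one
  root in \<open>\<Omega>\<close> chosen for each, gives the result.\<close>

section \<open>Embeddings between integer, rational and complex polynomials\<close>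

abbreviation of_int_poly :: "int poly \<Rightarrow> 'a::ring_char_0 poly" where
  "of_int_poly \<equiv> map_poly of_int"

lemma map_poly_mult_hom:
  assumes "f 0 = 0" and "\<And>x y. f (x + y) = f x + f y" and "\<And>x y. f (x * y) = f x * f y"
  shows "map_poly f (p * q) = map_poly f p * map_poly f q"
proof (rule poly_eqI)
  fix n
  have sum: "f (sum g A) = (\<Sum>x\<in>A. f (g x))" for g :: "nat \<Rightarrow> _" and A
    using assms by (induction A rule: infinite_finite_induct) auto
  show "coeff (map_poly f (p * q)) n = coeff (map_poly f p * map_poly f q) n"
    using assms by (simp add: coeff_map_poly coeff_mult sum)
qed

lemma of_int_poly_mult: "of_int_poly (p * q) = of_int_poly p * of_int_poly q"
  by (rule map_poly_mult_hom) auto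

lemma of_rat_poly_mult:
  "map_poly (of_rat :: rat \<Rightarrow> 'a::field_char_0) (p * q) = map_poly of_rat p * map_poly of_rat q"
  by (rule map_poly_mult_hom) (auto simp: of_rat_add of_rat_mult)

lemma of_rat_poly_add:
  "map_poly (of_rat :: rat \<Rightarrow> 'a::field_char_0) (p + q) = map_poly of_rat p + map_poly of_rat q"
  by (rule poly_eqI) (simp add: coeff_map_poly of_rat_add)

lemma of_rat_poly_of_int_poly: "map_poly of_rat (of_int_poly p) = of_int_poly p"
  by (rule poly_eqI) (simp add: coeff_map_poly)

lemma of_int_poly_eq_iff: "of_int_poly p = of_int_poly q \<longleftrightarrow> p = q"
  by (auto simp: poly_eq_iff coeff_map_poly)

lemma degree_of_int_poly: "degree (of_int_poly p) = degree p"
  by (rule degree_map_poly) auto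

lemma lead_coeff_of_int_poly: "lead_coeff (of_int_poly p) = of_int (lead_coeff p)"
  by (simp add: degree_of_int_poly coeff_map_poly)

section \<open>Gauss' lemma for monic factors\<close>

text \<open>Each coefficient in turn contributes its denominator as a factor of \<open>c\<close>.
  Positivity of \<open>c\<close> later allows it to be compared with a content.\<close>

lemma clear_denominators:
  fixes g :: "rat poly"
  obtains c G where "c > 0" and "smult (of_int c) g = of_int_poly G"
proof -
  have "\<exists>c>0. \<exists>G. smult (of_int c) g = of_int_poly G"
  proof (induction g)
    case 0
    show ?case by (intro exI[of _ 1] conjI exI[of _ 0]) auto
  next
    case (pCons a g)
    then obtain c G where c: "c > 0" "smult (of_int c) g = of_int_poly G" by blast
    obtain x y where xy: "quotient_of a = (x, y)" by force
    have y: "y > 0" and a: "a = of_int x / of_int y"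
      using quotient_of_denom_pos[OF xy] quotient_of_div[OF xy] by auto
    have "smult (of_int (y * c)) (pCons a g) =
        pCons (of_int (x * c)) (smult (of_int y) (smult (of_int c) g))"
      using y by (simp add: a)
    also have "\<dots> = of_int_poly (pCons (x * c) (smult y G))"
      by (simp add: c map_poly_pCons map_poly_smult)
    finally show ?case using c(1) y by (intro exI[of _ "y * c"]) auto
  qed
  then show ?thesis using that by blast
qed

text \<open>Clearing denominators in F = g q gives a b F = A B with integer A, B. As g and q are
  monic, A and B have leading coefficients a and b, so their contents are at most a and b. F is
  primitive and content is multiplicative, so the contents multiply to a b. Both bounds are
  therefore equalities, and g is the primitive part of A.\<close>

lemma monic_rat_dvd_monic_int:
  fixes g :: "rat poly"
  assumes g: "lead_coeff g = 1" and F: "lead_coeff F = 1" and dvd: "g dvd of_int_poly F"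
  obtains G where "g = of_int_poly G"
proof -
  obtain q where q: "of_int_poly F = g * q" using dvd by (auto simp: dvd_def)
  have lq: "lead_coeff q = 1"
    using g F lead_coeff_mult[of g q] lead_coeff_of_int_poly[of F, where 'a = rat] by (simp add: q)
  obtain a A where a: "a > 0" "smult (of_int a) g = of_int_poly A" by (rule clear_denominators)
  obtain b B where b: "b > 0" "smult (of_int b) q = of_int_poly B" by (rule clear_denominators)
  have "of_int_poly (smult (a * b) F) = smult (of_int a) g * smult (of_int b) q"
    by (simp add: map_poly_smult q mult.commute)
  also have "\<dots> = of_int_poly (A * B)" by (simp only: a(2) b(2) of_int_poly_mult)
  finally have AB: "smult (a * b) F = A * B" by (simp only: of_int_poly_eq_iff)
  have lA: "lead_coeff A = a"
    using arg_cong[OF a(2), of lead_coeff] g a(1) by (simp add: degree_of_int_poly coeff_map_poly)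
  have lB: "lead_coeff B = b"
    using arg_cong[OF b(2), of lead_coeff] lq b(1) by (simp add: degree_of_int_poly coeff_map_poly)
  have "content F dvd 1" using content_dvd_coeff[of F "degree F"] F by simp
  then have "content F = 1" by (simp only: is_unit_content_iff)
  then have eq: "a * b = content A * content B"
    using arg_cong[OF AB, of content] a(1) b(1) by (simp add: content_mult)
  have "content A dvd a" "content B dvd b" using content_dvd_coeff lA lB by metis+
  then have "content A \<le> a" "content B \<le> b" using a(1) b(1) by (auto intro: zdvd_imp_le)
  moreover have "content A \<ge> 0" "content B \<ge> 0"
    by (metis normalize_content normalize_int_def abs_ge_zero)+
  ultimately have "content A = a"
    using eq a(1) b(1) by (smt (verit) mult_less_cancel_right mult_left_mono mult_right_mono)
  then have "A = smult a (primitive_part A)" by (metis content_times_primitive_part)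
  then have "smult (of_int a) g = smult (of_int a) (of_int_poly (primitive_part A))"
    by (metis a(2) map_poly_smult of_int_0 of_int_mult)
  then have "g = of_int_poly (primitive_part A)"
    using a(1) by (metis less_irrefl of_int_eq_0_iff smult_cancel)
  then show ?thesis by (rule that)
qed

section \<open>Minimal polynomials over the rationals, and padding them to degree
  \<open>k\<close>\<close>

lemma is_min_rat_poly_min_rat_poly: "algebraic z \<Longrightarrow> is_min_rat_poly z (min_rat_poly z)"
  unfolding min_rat_poly_def by (rule theI'[OF is_min_rat_poly_ex1])

lemma is_min_rat_poly_root: "is_min_rat_poly z q \<Longrightarrow> poly (map_poly of_rat q) z = 0"
  and is_min_rat_poly_monic: "is_min_rat_poly z q \<Longrightarrow> lead_coeff q = 1"
  by (simp_all add: is_min_rat_poly_def)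

text \<open>The definition compares only with monic polynomials; dividing by the leading coefficient
  extends this to all nonzero ones.\<close>

lemma is_min_rat_poly_degree_le:
  assumes q: "is_min_rat_poly z q" and r: "r \<noteq> 0" "poly (map_poly of_rat r) z = 0"
  shows "degree q \<le> degree r"
proof -
  let ?s = "smult (inverse (lead_coeff r)) r"
  have "lead_coeff ?s = 1" "poly (map_poly of_rat ?s) z = 0"
    using r by (simp_all add: map_poly_smult of_rat_mult)
  then have "degree q \<le> degree ?s" using q unfolding is_min_rat_poly_def by blast
  then show ?thesis using r(1) by simp
qed

text \<open>The remainder of \<open>r\<close> modulo \<open>q\<close> also vanishes at
  \<open>z\<close> but has smaller degree, so it is zero.\<close>

lemma is_min_rat_poly_dvd:
  assumes q: "is_min_rat_poly z q" and r: "poly (map_poly of_rat r) z = 0"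
  shows "q dvd r"
proof (rule ccontr)
  assume "\<not> q dvd r"
  then have nz: "r mod q \<noteq> 0" by (simp add: dvd_eq_mod_eq_0)
  have "poly (map_poly of_rat (q * (r div q) + r mod q)) z = poly (map_poly of_rat (r mod q)) z"
    unfolding of_rat_poly_add of_rat_poly_mult poly_add poly_mult is_min_rat_poly_root[OF q] by simp
  then have "poly (map_poly of_rat (r mod q)) z = 0" using r by simp
  from is_min_rat_poly_degree_le[OF q nz this] have "degree q \<le> degree (r mod q)" .
  moreover have "q \<noteq> 0" using is_min_rat_poly_monic[OF q] by auto
  ultimately show False using degree_mod_less'[of q r] nz by simp
qed

lemma is_min_rat_poly_degree_pos:
  assumes "is_min_rat_poly z q"
  shows "degree q > 0"
proof (rule ccontr)
  assume "\<not> degree q > 0"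
  then obtain c where "q = [:c:]" by (auto elim: degree_eq_zeroE)
  then show False using is_min_rat_poly_root[OF assms] is_min_rat_poly_monic[OF assms]
    by (simp add: map_poly_pCons)
qed

text \<open>Gauss' lemma is applied to \<open>q\<close> and again to the cofactor \<open>s\<close>,
  so that the divisibility holds over the integers.\<close>

lemma is_min_rat_poly_int:
  assumes q: "is_min_rat_poly z q" and F: "lead_coeff F = 1" "poly (of_int_poly F) z = 0"
  obtains G where "q = of_int_poly G" and "G dvd F"
proof -
  have dvd: "q dvd of_int_poly F"
    using is_min_rat_poly_dvd[OF q] F(2) by (simp add: of_rat_poly_of_int_poly)
  obtain G where G: "q = of_int_poly G"
    using monic_rat_dvd_monic_int[OF is_min_rat_poly_monic[OF q] F(1) dvd] by blast
  obtain s where s: "of_int_poly F = q * s" using dvd by (auto simp: dvd_def)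
  have "lead_coeff s = 1"
    using is_min_rat_poly_monic[OF q] F lead_coeff_mult[of q s]
      lead_coeff_of_int_poly[of F, where 'a = rat] by (simp add: s)
  then obtain S where "s = of_int_poly S"
    using monic_rat_dvd_monic_int[OF _ F(1), of s] s by auto
  then have "of_int_poly F = (of_int_poly (G * S) :: rat poly)" by (simp add: s G of_int_poly_mult)
  then have "F = G * S" by (simp only: of_int_poly_eq_iff)
  then show ?thesis using that G by simp
qed

text \<open>Padding the minimal polynomial with a power of \<open>X\<close> makes all degrees equal to \<open>k\<close>,
  so that minimal polynomials of all degrees up to \<open>k\<close> can be counted at once.\<close>
definition padded_min_poly :: "nat \<Rightarrow> complex \<Rightarrow> int poly \<Rightarrow> bool" where
  "padded_min_poly k z h \<longleftrightarrow>
     (\<exists>G. is_min_rat_poly z (of_int_poly G) \<and> degree G \<le> k \<and> h = monom 1 (k - degree G) * G)"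

text \<open>Otherwise cancelling powers of X gives H = X^e G with e > 0, so \<open>w\<close> is a
  root of X or of \<open>G\<close>. Both have smaller degree than \<open>H\<close>: for X this holds
  because \<open>G\<close> is nonconstant, which forces \<open>H\<close> to have degree at least
  2.\<close>

lemma shifted_min_poly_degree:
  assumes z: "is_min_rat_poly z (of_int_poly G)" and w: "is_min_rat_poly w (of_int_poly H)"
    and k: "degree G \<le> k" "degree H \<le> k"
    and eq: "monom 1 (k - degree G) * G = monom 1 (k - degree H) * H"
  shows "degree H \<le> degree G"
proof (rule ccontr)
  assume "\<not> degree H \<le> degree G"
  then have less: "degree G < degree H" by simp
  define e where "e = degree H - degree G"
  have "monom 1 (k - degree G) = (monom 1 (k - degree H) * monom 1 e :: int poly)"
    using less k by (simp add: mult_monom e_def)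
  with eq have "monom 1 (k - degree H) * (monom 1 e * G) = monom 1 (k - degree H) * H"
    by (simp add: mult.assoc)
  then have H: "H = monom 1 e * G" by simp
  have "poly (of_int_poly H) w = 0"
    using is_min_rat_poly_root[OF w] by (simp add: of_rat_poly_of_int_poly)
  then have "w ^ e * poly (of_int_poly G) w = 0"
    by (simp add: H of_int_poly_mult map_poly_monom poly_monom)
  then consider "w = 0" | "poly (of_int_poly G) w = 0" by auto
  then show False
  proof cases
    case 1
    then have "poly (map_poly of_rat [:0, 1:]) w = 0" by (simp add: map_poly_pCons)
    from is_min_rat_poly_degree_le[OF w _ this] have "degree H \<le> 1"
      by (simp add: degree_of_int_poly)
    then show False using less is_min_rat_poly_degree_pos[OF z] by (simp add: degree_of_int_poly)
  next
    case 2
    then have "poly (map_poly of_rat (of_int_poly G)) w = 0" by (simp add: of_rat_poly_of_int_poly)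
    moreover have "of_int_poly G \<noteq> (0 :: rat poly)" using is_min_rat_poly_monic[OF z] by auto
    ultimately have "degree H \<le> degree G"
      using is_min_rat_poly_degree_le[OF w] by (metis degree_of_int_poly)
    then show False using less by simp
  qed
qed

text \<open>The degree comparison, used in both directions, shows that the padding is the same for
  both. Hence \<open>z\<close> and \<open>w\<close> share their minimal polynomial, which divides
  \<open>F\<close> over the rationals.\<close>

lemma padded_min_poly_same_roots:
  assumes z: "padded_min_poly k z h" and w: "padded_min_poly k w h"
    and root: "poly (of_int_poly F) z = 0"
  shows "poly (of_int_poly F) w = 0"
proof -
  obtain G where G: "is_min_rat_poly z (of_int_poly G)" "degree G \<le> k"
      "h = monom 1 (k - degree G) * G"
    using z unfolding padded_min_poly_def by blast
  obtain H where H: "is_min_rat_poly w (of_int_poly H)" "degree H \<le> k"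
      "h = monom 1 (k - degree H) * H"
    using w unfolding padded_min_poly_def by blast
  have eq: "monom 1 (k - degree G) * G = monom 1 (k - degree H) * H"
    by (rule trans[OF G(3)[symmetric] H(3)])
  have deg: "degree H = degree G"
    by (rule antisym[OF shifted_min_poly_degree[OF G(1) H(1) G(2) H(2) eq]
          shifted_min_poly_degree[OF H(1) G(1) H(2) G(2) eq[symmetric]]])
  have "H = G" using eq unfolding deg by simp
  have "of_int_poly G dvd (of_int_poly F :: rat poly)"
    using root by (intro is_min_rat_poly_dvd[OF G(1)]) (simp add: of_rat_poly_of_int_poly)
  then obtain s where s: "of_int_poly F = of_int_poly G * (s :: rat poly)" by (rule dvdE)
  have "of_int_poly F = (map_poly of_rat (of_int_poly H) * map_poly of_rat s :: complex poly)"
    by (metis s of_rat_poly_mult of_rat_poly_of_int_poly \<open>H = G\<close>)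
  then show ?thesis using is_min_rat_poly_root[OF H(1)] by simp
qed

section \<open>Counting monic integer polynomials with all roots in a disc\<close>

text \<open>The constraint is on roots rather than coefficients because it passes to divisors and,
  for \<open>0 \<le> M\<close>, survives multiplication by powers of X.\<close>

definition monic_int_polys :: "nat \<Rightarrow> real \<Rightarrow> int poly set" where
  "monic_int_polys k M =
     {h. degree h = k \<and> lead_coeff h = 1 \<and> (\<forall>w::complex. poly (of_int_poly h) w = 0 \<longrightarrow> norm w \<le> M)}"

text \<open>Roots of the minimal polynomial are roots of \<open>F\<close>, and padding adds only the
  root 0, which lies in the disc since \<open>0 \<le> M\<close>.\<close>

lemma padded_min_poly_exists:
  assumes alg: "algebraic z" "algebraic_degree z \<le> k"
    and F: "lead_coeff F = 1" "poly (of_int_poly F) z = 0"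
    and M: "0 \<le> M" "\<And>w::complex. poly (of_int_poly F) w = 0 \<Longrightarrow> norm w \<le> M"
  shows "\<exists>h\<in>monic_int_polys k M. padded_min_poly k z h"
proof -
  note q = is_min_rat_poly_min_rat_poly[OF alg(1)]
  obtain G where G: "min_rat_poly z = of_int_poly G" "G dvd F"
    using is_min_rat_poly_int[OF q F] .
  have deg: "degree G \<le> k" using alg(2) by (simp add: algebraic_degree_def G degree_of_int_poly)
  have lead: "lead_coeff G = 1"
    using is_min_rat_poly_monic[OF q] by (simp add: G degree_of_int_poly coeff_map_poly)
  let ?h = "monom 1 (k - degree G) * G"
  have "norm w \<le> M" if "poly (of_int_poly ?h) w = 0" for w :: complex
  proof -
    have "w ^ (k - degree G) * poly (of_int_poly G) w = 0"
      using that by (simp add: of_int_poly_mult map_poly_monom poly_monom)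
    moreover have "norm w \<le> M" if "poly (of_int_poly G) w = 0"
      using that G(2) M(2)[of w] by (auto simp: of_int_poly_mult dvd_def)
    ultimately show ?thesis using M(1) by auto
  qed
  moreover have "degree ?h = k"
    using deg lead by (subst degree_mult_eq) (auto simp: degree_monom_eq)
  moreover have "lead_coeff ?h = 1" using lead by (simp add: lead_coeff_mult degree_monom_eq)
  ultimately have "?h \<in> monic_int_polys k M" unfolding monic_int_polys_def by blast
  moreover have "padded_min_poly k z ?h"
    using q deg unfolding padded_min_poly_def by (metis G(1))
  ultimately show ?thesis by blast
qed

text \<open>The bound is the corresponding coefficient of (X + M)^n with n = \<open>size A\<close>;
  the induction step is Pascal's rule.\<close>

lemma norm_coeff_prod_linear_factors_le:
  fixes A :: "'a::real_normed_field multiset"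
  assumes "\<And>x. x \<in># A \<Longrightarrow> norm x \<le> M"
  shows "norm (coeff (\<Prod>x\<in>#A. [:-x, 1:]) i) \<le> real (size A choose i) * M ^ (size A - i)"
  using assms
proof (induction A arbitrary: i)
  case empty
  show ?case by (cases i) auto
next
  case (add x A)
  let ?P = "\<Prod>x\<in>#A. [:-x, 1:]" and ?n = "size A"
  have x: "norm x \<le> M" and M: "0 \<le> M" using add.prems[of x] norm_ge_zero[of x] by (simp_all del: norm_ge_zero)
  have IH: "norm (coeff ?P i) \<le> real (?n choose i) * M ^ (?n - i)" for i
    using add by simp
  show ?case
  proof (cases i)
    case 0
    then have "norm (coeff (\<Prod>x\<in>#add_mset x A. [:-x, 1:]) i) = norm x * norm (coeff ?P 0)"
      by (simp add: norm_mult)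
    also have "\<dots> \<le> M * M ^ ?n" using IH[of 0] x M by (intro mult_mono) auto
    finally show ?thesis by (simp add: 0)
  next
    case (Suc j)
    have "norm (coeff (\<Prod>x\<in>#add_mset x A. [:-x, 1:]) i) = norm (coeff ?P j - x * coeff ?P (Suc j))"
      by (simp add: Suc)
    also have "\<dots> \<le> norm (coeff ?P j) + norm x * norm (coeff ?P (Suc j))"
      by (metis norm_mult norm_triangle_ineq4)
    also have "\<dots> \<le> real (?n choose j) * M ^ (?n - j) + M * (real (?n choose Suc j) * M ^ (?n - Suc j))"
      by (intro add_mono mult_mono IH x M norm_ge_zero)
    \<comment> \<open>If \<open>Suc j > ?n\<close>, truncated subtraction spoils the exponents, but
      the binomial coefficient is then 0.\<close>
    also have "M * (real (?n choose Suc j) * M ^ (?n - Suc j)) = real (?n choose Suc j) * M ^ (?n - j)"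
    proof (cases "Suc j \<le> ?n")
      case True
      then have "?n - j = Suc (?n - Suc j)" by simp
      then show ?thesis by simp
    qed (simp add: binomial_eq_0)
    finally show ?thesis by (simp add: Suc algebra_simps)
  qed
qed

text \<open>Over the complex numbers \<open>h\<close> is the product of its \<open>k\<close> linear
  factors, to which the preceding bound applies.\<close>

lemma coeff_monic_int_polys:
  assumes h: "h \<in> monic_int_polys k M"
  shows "\<bar>real_of_int (coeff h i)\<bar> \<le> real (k choose i) * M ^ (k - i)"
proof -
  let ?h = "of_int_poly h :: complex poly"
  have lead: "lead_coeff ?h = 1" and nz: "?h \<noteq> 0" and size: "size (proots ?h) = k"
    using h lead_coeff_of_int_poly[of h, where 'a = complex]
    by (auto simp: monic_int_polys_def size_proots_complex degree_of_int_poly)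
  have eq: "(\<Prod>x\<in>#proots ?h. [:-x, 1:]) = ?h"
    using complex_poly_decompose_multiset[of ?h] unfolding lead by simp
  have "norm (coeff (\<Prod>x\<in>#proots ?h. [:-x, 1:]) i) \<le>
      real (size (proots ?h) choose i) * M ^ (size (proots ?h) - i)"
    by (rule norm_coeff_prod_linear_factors_le)
       (use h nz in \<open>simp add: monic_int_polys_def\<close>)
  then show ?thesis by (simp add: eq size coeff_map_poly)
qed

text \<open>The constant coefficient is an integer of absolute value below 1, hence 0. So X can be
  divided out, and the quotient satisfies the same root bound in degree one less.\<close>

lemma monic_int_polys_small_radius:
  assumes "0 \<le> M" "M < 1"
  shows "monic_int_polys k M \<subseteq> {monom 1 k}"
proof -
  have "h = monom 1 k" if "h \<in> monic_int_polys k M" for h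
    using that
  proof (induction k arbitrary: h)
    case 0
    then show ?case
      by (auto simp: monic_int_polys_def elim!: degree_eq_zeroE)
  next
    case (Suc k)
    have "\<bar>real_of_int (coeff h 0)\<bar> \<le> M ^ Suc k"
      using coeff_monic_int_polys[OF Suc.prems, of 0] by simp
    also have "\<dots> \<le> M" using power_decreasing[of 1 "Suc k" M] assms by simp
    also have "\<dots> < 1" by fact
    finally have "coeff h 0 = 0" by linarith
    then obtain g where g: "h = pCons 0 g" by (cases h) auto
    have "g \<noteq> 0" using Suc.prems g by (auto simp: monic_int_polys_def)
    then have "g \<in> monic_int_polys k M"
      using Suc.prems by (auto simp: monic_int_polys_def g map_poly_pCons)
    from Suc.IH[OF this] show ?case by (simp add: g monom_Suc)
  qed
  then show ?thesis by blast
qed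

text \<open>A monic polynomial of degree \<open>k\<close> is determined by its \<open>k\<close>
  lower coefficients, each an integer between \<open>-B\<close> and \<open>B\<close>.\<close>

lemma card_monic_int_polys_le:
  assumes B: "0 \<le> B" and coeff: "\<And>h i. h \<in> monic_int_polys k M \<Longrightarrow> i < k \<Longrightarrow> \<bar>real_of_int (coeff h i)\<bar> \<le> B"
  shows "finite (monic_int_polys k M)" and "real (card (monic_int_polys k M)) \<le> (2 * B + 1) ^ k"
proof -
  let ?b = "\<lfloor>B\<rfloor>" and ?f = "\<lambda>h. map (coeff h) [0..<k]"
  let ?L = "{xs. set xs \<subseteq> {-?b..?b} \<and> length xs = k}"
  have inj: "inj_on ?f (monic_int_polys k M)"
  proof (rule inj_onI)
    fix g h assume g: "g \<in> monic_int_polys k M" and h: "h \<in> monic_int_polys k M" and eq: "?f g = ?f h"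
    show "g = h"
    proof (rule poly_eqI)
      fix i
      show "coeff g i = coeff h i"
        using g h eq by (cases i k rule: linorder_cases) (auto simp: monic_int_polys_def coeff_eq_0)
    qed
  qed
  have "\<bar>coeff h i\<bar> \<le> ?b" if "h \<in> monic_int_polys k M" "i < k" for h i
    using coeff[OF that] by (simp add: le_floor_iff)
  then have "coeff h i \<in> {-?b..?b}" if "h \<in> monic_int_polys k M" "i < k" for h i
    using that by (metis abs_le_iff atLeastAtMost_iff minus_le_iff)
  then have sub: "?f ` monic_int_polys k M \<subseteq> ?L" by auto
  have fin: "finite ?L" by (rule finite_lists_length_eq) simp
  then show "finite (monic_int_polys k M)" using inj sub by (meson finite_imageD finite_subset)
  have "card (monic_int_polys k M) \<le> card ?L" using inj sub fin by (rule card_inj_on_le)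
  also have "\<dots> = nat (2 * ?b + 1) ^ k" by (simp add: card_lists_length_eq)
  finally have "real (card (monic_int_polys k M)) \<le> real (nat (2 * ?b + 1)) ^ k"
    by (metis of_nat_le_iff of_nat_power)
  also have "\<dots> \<le> (2 * B + 1) ^ k"
    using B by (intro power_mono) (auto simp: of_nat_nat)
  finally show "real (card (monic_int_polys k M)) \<le> (2 * B + 1) ^ k" .
qed

text \<open>By Pascal's rule the left side is a sum of two distinct entries of row \<open>n\<close>.
  The factor 2 gained over the full row sum matters: without it the count for \<open>k = 2\<close>
  would require 9 \<le> e^2, which is false.\<close>

lemma binomial_le_two_power: "(Suc n choose i) \<le> 2 ^ n"
proof (cases i)
  case (Suc j)
  have "(n choose j) + (n choose Suc j) = sum (\<lambda>i. n choose i) {j, Suc j}" by simp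
  \<comment> \<open>The limit \<open>max n (Suc j)\<close> covers \<open>Suc j > n\<close>, where
    the index leaves the row; the added terms are 0.\<close>
  also have "\<dots> \<le> sum (\<lambda>i. n choose i) {..max n (Suc j)}" by (rule sum_mono2) auto
  also have "\<dots> = sum (\<lambda>i. n choose i) {..n}"
    by (rule sum.mono_neutral_right) (auto simp: binomial_eq_0)
  also have "\<dots> = 2 ^ n" by (rule choose_row_sum)
  finally show ?thesis by (simp add: Suc)
qed simp

lemma card_monic_int_polys_le_exp:
  assumes k: "2 \<le> k" and M: "0 \<le> M" "1 \<le> exp 1 * M"
  shows "finite (monic_int_polys k M)"
    and "real (card (monic_int_polys k M)) \<le> (exp 1 * M) ^ (k\<^sup>2)"
proof -
  have "finite (monic_int_polys k M) \<and> real (card (monic_int_polys k M)) \<le> (exp 1 * M) ^ (k\<^sup>2)"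
  proof (cases "M < 1")
    case True
    have sub: "monic_int_polys k M \<subseteq> {monom 1 k}" using M True by (intro monic_int_polys_small_radius)
    then have "card (monic_int_polys k M) \<le> 1" using card_mono[OF _ sub] by simp
    \<comment> \<open>The single polynomial X^k must still be covered by the bound; this is where
      \<open>1 \<le> exp 1 * M\<close> enters.\<close>
    moreover have "1 \<le> (exp 1 * M) ^ (k\<^sup>2)" using M by (intro one_le_power)
    ultimately show ?thesis using finite_subset[OF sub] by simp
  next
    case False
    define B where "B = 2 ^ (k - 1) * M ^ k"
    have B0: "0 \<le> B" using M by (simp add: B_def)
    have B: "\<bar>real_of_int (coeff h i)\<bar> \<le> B" if "h \<in> monic_int_polys k M" for h i
    proof -
      have "(k choose i) \<le> 2 ^ (k - 1)" using binomial_le_two_power[of "k - 1" i] k by simp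
      then have "real (k choose i) \<le> 2 ^ (k - 1)" by (metis of_nat_le_iff of_nat_numeral of_nat_power)
      moreover have "M ^ (k - i) \<le> M ^ k" using False by (intro power_increasing) auto
      ultimately have "real (k choose i) * M ^ (k - i) \<le> B"
        unfolding B_def using M by (intro mult_mono) auto
      then show ?thesis using coeff_monic_int_polys[OF that, of i] by linarith
    qed
    \<comment> \<open>The base case follows from e \<ge> 5/2, as 25/4 \<ge> 5. At
      \<open>k = 1\<close> the inequality fails, since 3 > e, whence the separate constant 3
      there.\<close>
    have e: "2 ^ k + 1 \<le> (exp 1 :: real) ^ k"
      using k
    proof (induction k rule: dec_induct)
      case base
      have "(5/2) ^ 2 \<le> (exp 1 :: real) ^ 2"
        using exp_lower_Taylor_quadratic[of "1::real"] by (intro power_mono) auto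
      then show ?case by (simp add: power2_eq_square)
    next
      case (step m)
      have "2 ^ Suc m + 1 \<le> 2 * (2 ^ m + 1 :: real)" by simp
      also have "\<dots> \<le> exp 1 * exp 1 ^ m"
        using step exp_ge_add_one_self[of 1] by (intro mult_mono) auto
      finally show ?case by simp
    qed
    have "1 \<le> M ^ k" using False by simp
    have "2 * 2 ^ (k - 1) = (2 ^ k :: real)" using k by (cases k) simp_all
    then have "2 * B = 2 ^ k * M ^ k" by (simp add: B_def flip: mult.assoc)
    \<comment> \<open>The summand 1 is absorbed into \<open>M ^ k\<close>, which is at least 1 in
      this case.\<close>
    then have "2 * B + 1 \<le> (2 ^ k + 1) * M ^ k" using \<open>1 \<le> M ^ k\<close> by (simp add: distrib_right)
    also have "\<dots> \<le> exp 1 ^ k * M ^ k" using e M by (intro mult_right_mono) auto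
    finally have "2 * B + 1 \<le> (exp 1 * M) ^ k" by (simp add: power_mult_distrib)
    then have "(2 * B + 1) ^ k \<le> ((exp 1 * M) ^ k) ^ k" using B0 by (intro power_mono) auto
    also have "\<dots> = (exp 1 * M) ^ (k\<^sup>2)" by (simp add: power2_eq_square power_mult)
    finally show ?thesis using card_monic_int_polys_le[OF B0 B, of k M] by auto
  qed
  then show "finite (monic_int_polys k M)"
    and "real (card (monic_int_polys k M)) \<le> (exp 1 * M) ^ (k\<^sup>2)" by auto
qed

lemma card_monic_int_polys_1_le:
  assumes M: "0 \<le> M" "1 \<le> 3 * M"
  shows "finite (monic_int_polys 1 M)" and "real (card (monic_int_polys 1 M)) \<le> 3 * M"
proof -
  have "finite (monic_int_polys 1 M) \<and> real (card (monic_int_polys 1 M)) \<le> 3 * M"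
  proof (cases "M < 1")
    case True
    have sub: "monic_int_polys 1 M \<subseteq> {monom 1 1}" using M True by (intro monic_int_polys_small_radius)
    then have "card (monic_int_polys 1 M) \<le> 1" using card_mono[OF _ sub] by simp
    then show ?thesis using M finite_subset[OF sub] by simp
  next
    case False
    have "\<bar>real_of_int (coeff h i)\<bar> \<le> M" if "h \<in> monic_int_polys 1 M" "i < 1" for h i
      using coeff_monic_int_polys[OF that(1), of i] that(2) by simp
    \<comment> \<open>With \<open>B = M\<close> the count is at most 2 M + 1, and this is at most 3
      M because M \<ge> 1.\<close>
    from card_monic_int_polys_le[of M 1 M, OF M(1) this] show ?thesis using False by simp
  qed
  then show "finite (monic_int_polys 1 M)" and "real (card (monic_int_polys 1 M)) \<le> 3 * M" by auto
qed

section \<open>Measurability for the random polynomial and the union bound\<close>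

lemma random_poly_int:
  obtains F where "random_poly n \<xi> \<omega> = of_int_poly F" and "lead_coeff F = 1"
proof
  let ?F = "monom 1 n + (\<Sum>i<n. monom (\<xi> i \<omega>) i)"
  have c: "coeff ?F j = (if j = n then 1 else if j < n then \<xi> j \<omega> else 0)" for j
    by (auto simp: coeff_sum)
  show "random_poly n \<xi> \<omega> = of_int_poly ?F"
    by (rule poly_eqI) (auto simp: c coeff_map_poly random_poly_def coeff_sum)
  have "degree ?F \<le> n" by (rule degree_le) (simp only: c, simp)
  moreover have "n \<le> degree ?F" by (rule le_degree) (simp only: c, simp)
  ultimately have "degree ?F = n" by simp
  then show "lead_coeff ?F = 1" by (simp only: c) simp
qed

text \<open>There are only countably many integer coefficient lists, so an arbitrary property
  \<open>Q\<close> of the polynomial cuts out a countable union of measurable fibres.\<close>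

lemma random_poly_event_measurable:
  assumes \<xi>: "\<And>i. i < n \<Longrightarrow> \<xi> i \<in> measurable P (count_space UNIV)"
  shows "{\<omega> \<in> space P. Q (random_poly n \<xi> \<omega>)} \<in> sets P"
proof -
  \<comment> \<open>A one-point sample space turns a coefficient list into a deterministic
    polynomial.\<close>
  define g :: "int list \<Rightarrow> complex poly"
    where "g xs = random_poly n (\<lambda>i _. xs ! i) ()" for xs
  let ?E = "\<lambda>xs. {\<omega> \<in> space P. \<forall>i\<in>{..<n}. \<xi> i \<omega> = xs ! i}"
  have g: "random_poly n \<xi> \<omega> = g xs" if "\<forall>i\<in>{..<n}. \<xi> i \<omega> = xs ! i" for \<omega> xs
    using that by (simp add: g_def random_poly_def)
  have eq: "{\<omega> \<in> space P. Q (random_poly n \<xi> \<omega>)} = (\<Union>xs\<in>{xs. Q (g xs)}. ?E xs)" (is "?L = ?R")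
  proof
    show "?L \<subseteq> ?R"
    proof
      fix \<omega> assume \<omega>: "\<omega> \<in> ?L"
      have "\<forall>i\<in>{..<n}. \<xi> i \<omega> = map (\<lambda>i. \<xi> i \<omega>) [0..<n] ! i" by simp
      with g[OF this] \<omega> show "\<omega> \<in> ?R" by fastforce
    qed
    show "?R \<subseteq> ?L"
    proof
      fix \<omega> assume "\<omega> \<in> ?R"
      then obtain xs where "Q (g xs)" "\<omega> \<in> space P" "\<forall>i\<in>{..<n}. \<xi> i \<omega> = xs ! i" by blast
      then show "\<omega> \<in> ?L" using g[of \<omega> xs] by simp
    qed
  qed
  have "?E xs \<in> sets P" for xs
  proof (rule sets.sets_Collect_finite_All)
    fix i assume "i \<in> {..<n}"
    then have "\<xi> i -` {xs ! i} \<inter> space P \<in> sets P" using \<xi> by (auto intro: measurable_sets)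
    moreover have "\<xi> i -` {xs ! i} \<inter> space P = {\<omega> \<in> space P. \<xi> i \<omega> = xs ! i}" by auto
    ultimately show "{\<omega> \<in> space P. \<xi> i \<omega> = xs ! i} \<in> sets P" by simp
  qed simp
  moreover have "countable {xs. Q (g xs)}" by (rule countableI_type)
  ultimately show ?thesis unfolding eq by (intro sets.countable_UN' image_subsetI)
qed

text \<open>The roots of a padded minimal polynomial in \<open>\<Omega>\<close> stand or fall together as roots of the random
  polynomial, so one representative root per element of \<^term>\<open>monic_int_polys k M\<close>
  suffices for the union bound.\<close>
lemma low_degree_root_probability_le:
  fixes P :: "'a measure" and \<xi> :: "nat \<Rightarrow> 'a \<Rightarrow> int"
  assumes "prob_space P"
    and \<xi>: "\<And>i. i < n \<Longrightarrow> \<xi> i \<in> measurable P (count_space UNIV)"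
    and M: "0 \<le> M" and p: "0 \<le> p"
    and le: "\<And>z. z \<in> \<Omega> \<Longrightarrow> measure P {\<omega> \<in> space P. poly (random_poly n \<xi> \<omega>) z = 0} \<le> p"
    and fin: "finite (monic_int_polys k M)"
  shows "measure P {\<omega> \<in> space P. \<exists>z\<in>\<Omega>. poly (random_poly n \<xi> \<omega>) z = 0 \<and>
             algebraic z \<and> algebraic_degree z \<le> k}
         \<le> p * real (card (monic_int_polys k M))
           + measure P {\<omega> \<in> space P. \<exists>w \<in># proots (random_poly n \<xi> \<omega>). norm w > M}"
    (is "measure P ?E \<le> _ + measure P ?bad")
proof -
  interpret prob_space P by fact
  define H where "H = {h \<in> monic_int_polys k M. \<exists>z\<in>\<Omega>. padded_min_poly k z h}"
  have "\<forall>h\<in>H. \<exists>z. z \<in> \<Omega> \<and> padded_min_poly k z h" by (auto simp: H_def)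
  from bchoice[OF this]
  obtain r where r: "\<And>h. h \<in> H \<Longrightarrow> r h \<in> \<Omega> \<and> padded_min_poly k (r h) h" by blast
  have finH: "finite H" and cardH: "card H \<le> card (monic_int_polys k M)"
    using fin by (auto simp: H_def intro: card_mono)
  let ?A = "\<lambda>z. {\<omega> \<in> space P. poly (random_poly n \<xi> \<omega>) z = 0}"
  have A: "?A z \<in> events" for z using \<xi> by (rule random_poly_event_measurable)
  have bad: "?bad \<in> events" using \<xi> by (rule random_poly_event_measurable)
  have "?E \<subseteq> (\<Union>h\<in>H. ?A (r h)) \<union> ?bad"
  proof
    fix \<omega> assume \<omega>: "\<omega> \<in> ?E"
    then obtain z where z: "z \<in> \<Omega>" "poly (random_poly n \<xi> \<omega>) z = 0" "algebraic z"
        "algebraic_degree z \<le> k" by blast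
    obtain F where F: "random_poly n \<xi> \<omega> = of_int_poly F" "lead_coeff F = 1"
      by (rule random_poly_int)
    have nz: "random_poly n \<xi> \<omega> \<noteq> 0"
      using F lead_coeff_of_int_poly[of F, where 'a = complex] by auto
    show "\<omega> \<in> (\<Union>h\<in>H. ?A (r h)) \<union> ?bad"
    proof (cases "\<omega> \<in> ?bad")
      case False
      then have "norm w \<le> M" if "poly (of_int_poly F) w = 0" for w :: complex
        using that \<omega> nz F(1) by (auto simp: not_less)
      then obtain h where h: "h \<in> monic_int_polys k M" "padded_min_poly k z h"
        using padded_min_poly_exists[OF z(3,4) F(2) _ M] z(2) F(1) by auto
      then have "h \<in> H" using z(1) by (auto simp: H_def)
      \<comment> \<open>The root moves from \<open>z\<close>, which depends on the outcome, to the
        fixed representative \<open>r h\<close>, so only finitely many events remain.\<close>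
      moreover have "poly (random_poly n \<xi> \<omega>) (r h) = 0"
        using padded_min_poly_same_roots[OF h(2)] r[OF \<open>h \<in> H\<close>] z(2) unfolding F(1) by blast
      ultimately show ?thesis using \<omega> by blast
    qed simp
  qed
  moreover have UN: "(\<Union>h\<in>H. ?A (r h)) \<in> events" by (intro sets.finite_UN finH A)
  ultimately have "prob ?E \<le> prob ((\<Union>h\<in>H. ?A (r h)) \<union> ?bad)"
    by (intro finite_measure_mono sets.Un bad)
  also have "\<dots> \<le> prob (\<Union>h\<in>H. ?A (r h)) + prob ?bad"
    by (intro measure_Un_le UN bad)
  also have "prob (\<Union>h\<in>H. ?A (r h)) \<le> (\<Sum>h\<in>H. prob (?A (r h)))"
    by (intro finite_measure_subadditive_finite finH image_subsetI A)
  also have "\<dots> \<le> (\<Sum>h\<in>H. p)" by (intro sum_mono le) (use r in blast)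
  also have "\<dots> \<le> p * real (card (monic_int_polys k M))"
    using p cardH by (simp add: mult.commute[of p] mult_right_mono)
  finally show ?thesis by simp
qed

text \<open>The conditions \<open>1 \<le> exp 1 * M\<close> and \<open>1 \<le> 3 * M\<close> make
  room for the polynomial X^k, which is always counted. For f = X^n, \<Omega> = {0} and p = 1 the
  probability on the left is 1 and no root exceeds \<open>M\<close>, so the bounds fail once e M < 1
  or 3 M < 1 respectively. The supremum is taken in the extended nonnegative reals, where it is 0
  for empty \<Omega>.\<close>

theorem theorem1p7:
  fixes P :: "'a measure" and \<xi> :: "nat \<Rightarrow> 'a \<Rightarrow> int"
    and n k :: nat and M p :: real and \<Omega> :: "complex set"
  assumes "prob_space P"
    and "\<And>i. i < n \<Longrightarrow> \<xi> i \<in> measurable P (count_space UNIV)"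
    and "0 < M"
    and "1 \<le> k" and "k \<le> n"
    and "\<Omega> \<subseteq> {z. norm z \<le> M}"
    and "0 \<le> p" and "p \<le> 1"
    and "(SUP z\<in>\<Omega>. emeasure P {\<omega> \<in> space P. poly (random_poly n \<xi> \<omega>) z = 0}) \<le> ennreal p"
  shows "(2 \<le> k \<and> 1 \<le> exp 1 * M \<longrightarrow>
            measure P {\<omega> \<in> space P. \<exists>z\<in>\<Omega>. poly (random_poly n \<xi> \<omega>) z = 0 \<and>
                                      algebraic z \<and> algebraic_degree z \<le> k}
              \<le> p * (exp 1 * M) ^ (k\<^sup>2)
                + measure P {\<omega> \<in> space P. \<exists>w \<in># proots (random_poly n \<xi> \<omega>). norm w > M})
       \<and> (k = 1 \<and> 1 \<le> 3 * M \<longrightarrow>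
            measure P {\<omega> \<in> space P. \<exists>z\<in>\<Omega>. poly (random_poly n \<xi> \<omega>) z = 0 \<and>
                                      algebraic z \<and> algebraic_degree z \<le> k}
              \<le> p * (3 * M)
                + measure P {\<omega> \<in> space P. \<exists>w \<in># proots (random_poly n \<xi> \<omega>). norm w > M})"
proof -
  interpret prob_space P by (rule assms(1))
  have le: "measure P {\<omega> \<in> space P. poly (random_poly n \<xi> \<omega>) z = 0} \<le> p" if "z \<in> \<Omega>" for z
  proof -
    have "emeasure P {\<omega> \<in> space P. poly (random_poly n \<xi> \<omega>) z = 0} \<le> ennreal p"
      using assms(9) SUP_upper[OF that] by (rule order_trans[rotated])
    then show ?thesis using assms(7) by (simp add: emeasure_eq_measure)
  qed
  have M: "0 \<le> M" using assms(3) by simp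
  note bound = low_degree_root_probability_le[OF assms(1,2) M assms(7) le]
  show ?thesis
  proof (intro conjI impI; elim conjE)
    assume k: "2 \<le> k" "1 \<le> exp 1 * M"
    note card = card_monic_int_polys_le_exp[OF k(1) M k(2)]
    show "measure P {\<omega> \<in> space P. \<exists>z\<in>\<Omega>. poly (random_poly n \<xi> \<omega>) z = 0 \<and>
              algebraic z \<and> algebraic_degree z \<le> k}
          \<le> p * (exp 1 * M) ^ (k\<^sup>2)
            + measure P {\<omega> \<in> space P. \<exists>w \<in># proots (random_poly n \<xi> \<omega>). norm w > M}"
      using bound[OF _ _ card(1)] mult_left_mono[OF card(2) assms(7)] by fastforce
  next
    assume k: "k = 1" "1 \<le> 3 * M"
    note card = card_monic_int_polys_1_le[OF M k(2)]
    show "measure P {\<omega> \<in> space P. \<exists>z\<in>\<Omega>. poly (random_poly n \<xi> \<omega>) z = 0 \<and>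
              algebraic z \<and> algebraic_degree z \<le> k}
          \<le> p * (3 * M)
            + measure P {\<omega> \<in> space P. \<exists>w \<in># proots (random_poly n \<xi> \<omega>). norm w > M}"
      using bound[OF _ _ card(1)] mult_left_mono[OF card(2) assms(7)] unfolding k(1) by fastforce
  qed
qed

end
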